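(* Let $X$ be a real Banach space with a normalized Schauder basis $(e_n)_{n\in\mathbb N}$ and let $w=(w_n)$ be a weight sequence. (a) If $(e_n)$ is $C_{rp}$-$w$-reverse partially greedy, then $(e_n)$ is $(C_{rp}+1)$-quasi-greedy and has $C_{rp}$-$w$-right Property $(A)$. (b) If $(e_n)$ has $C_{ra}$-$w$-right Property $(A)$ and is $C_q$-quasi-greedy, then $(e_n)$ is $(C_q+1)C_{ra}$-$w$-reverse partially greedy.
   Context: Let $(e_n^* )$ be the biorthogonal functionals of $(e_n)$, and $\mathrm{supp}(x)=\{n: e_n^*(x)\ne0\}$. A weight sequence $w=(w_n)_{n\in\mathbb N}$ is a sequence of positive real numbers; $w(A)=\sum_{i\in A}w_i$ for $A\subset\mathbb N$. $\mathbb N^{<\infty}$ is the set of all finite subsets of $\mathbb N$ (including $\emptyset$). $\mathcal A$ is the set of all sequences $\varepsilon=(\varepsilon_i)_{i\in\mathbb N}$ with $\varepsilon_i\in\{1,-1\}$. For $A\in\mathbb N^{<\infty}$ and $\varepsilon\in\mathcal A$: $1_{\varepsilon A}=\sum_{i\in A}\varepsilon_ie_i$ and $P_A(x)=\sum_{i\in A}e_i^*(x)e_i$. $A<B$ means that every element of $A$ is smaller than every element of $B$ (so it holds if $A$ or $B$ is empty); for $n\in\mathbb N$, $n<A$ means $\{n\}<A$. For $x\in X$ and $m\in\mathbb N$, $\Lambda_m(x)$ denotes any set of $m$ indices with $\min_{n\in\Lambda_m(x)}|e_n^*(x)|\ge\max_{n\notin\Lambda_m(x)}|e_n^*(x)|$;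 the corresponding $m$-th greedy approximant is $G_m(x)=\sum_{n\in\Lambda_m(x)}e_n^*(x)e_n$, and $\beta_m(x)=\max\Lambda_m(x)$. Conditions involving $G_m(x)$ are required for every admissible choice of $\Lambda_m(x)$. $(e_n)$ is $C$-quasi-greedy if $\|G_m(x)\|\le C\|x\|$ for all $x\in X$, $m\in\mathbb N$. $(e_n)$ is $C$-$w$-reverse partially greedy if for all $x\in X$, $m\in\mathbb N$, $$\|x-G_m(x)\|\le C\inf\{\|x-P_A(x)\|: A\in\mathbb N^{<\infty},\ w(A)\le w(\Lambda_m(x)),\ \beta_m(x)<A\}.$$ $(e_n)$ has $C$-$w$-right Property $(A)$ ($C\ge1$) if $\|x+t1_{\varepsilon A}\|\le C\|x+t1_{\eta B}\|$ for all $x\in X$, $t\ge\sup_j|e_j^*(x)|$, $A,B\in\mathbb N^{<\infty}$ with $B<A$, $w(A)\le w(B)$, $\mathrm{supp}(x)\cap(A\cup B)=\emptyset$, and $\varepsilon,\eta\in\mathcal A$. *)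

theory Defs
  imports "HOL-Analysis.Analysis"
begin

definition schauder_basis :: "(nat \<Rightarrow> 'a::banach) \<Rightarrow> bool" where
  "schauder_basis e \<longleftrightarrow> (\<forall>x. \<exists>!a. (\<lambda>n. a n *\<^sub>R e n) sums x)"

(* coord e n x stands for e_n^*(x): the biorthogonal functionals of a Schauder basis are its
   coordinate functionals. The value is only meaningful when schauder_basis e holds. *)
definition coord :: "(nat \<Rightarrow> 'a::banach) \<Rightarrow> nat \<Rightarrow> 'a \<Rightarrow> real" where
  "coord e n x = (THE a. (\<lambda>k. a k *\<^sub>R e k) sums x) n"

definition supp :: "(nat \<Rightarrow> 'a::banach) \<Rightarrow> 'a \<Rightarrow> nat set" where
  "supp e x = {n. coord e n x \<noteq> 0}"

definition weight :: "(nat \<Rightarrow> real) \<Rightarrow> bool" where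
  "weight w \<longleftrightarrow> (\<forall>n. 0 < w n)"

definition proj :: "(nat \<Rightarrow> 'a::banach) \<Rightarrow> nat set \<Rightarrow> 'a \<Rightarrow> 'a" where
  "proj e A x = (\<Sum>n\<in>A. coord e n x *\<^sub>R e n)"

definition signs :: "(nat \<Rightarrow> real) set" where
  "signs = {\<epsilon>. \<forall>i. \<epsilon> i \<in> {1, -1}}"

definition signed_sum :: "(nat \<Rightarrow> 'a::banach) \<Rightarrow> (nat \<Rightarrow> real) \<Rightarrow> nat set \<Rightarrow> 'a" where
  "signed_sum e \<epsilon> A = (\<Sum>i\<in>A. \<epsilon> i *\<^sub>R e i)"

definition set_before :: "nat set \<Rightarrow> nat set \<Rightarrow> bool" where
  "set_before A B \<longleftrightarrow> (\<forall>a\<in>A. \<forall>b\<in>B. a < b)"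

(* greedy_set e m x L: L is an admissible choice of the index set Lambda_m(x). The corresponding
   greedy approximant G_m(x) is proj e L x, and beta_m(x) is Max L. *)
definition greedy_set :: "(nat \<Rightarrow> 'a::banach) \<Rightarrow> nat \<Rightarrow> 'a \<Rightarrow> nat set \<Rightarrow> bool" where
  "greedy_set e m x L \<longleftrightarrow>
     finite L \<and> card L = m \<and> (\<forall>n\<in>L. \<forall>k. k \<notin> L \<longrightarrow> \<bar>coord e k x\<bar> \<le> \<bar>coord e n x\<bar>)"

definition quasi_greedy :: "real \<Rightarrow> (nat \<Rightarrow> 'a::banach) \<Rightarrow> bool" where
  "quasi_greedy C e \<longleftrightarrow>
     (\<forall>x m L. 1 \<le> m \<longrightarrow> greedy_set e m x L \<longrightarrow> norm (proj e L x) \<le> C * norm x)"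

definition reverse_partially_greedy ::
    "real \<Rightarrow> (nat \<Rightarrow> real) \<Rightarrow> (nat \<Rightarrow> 'a::banach) \<Rightarrow> bool" where
  "reverse_partially_greedy C w e \<longleftrightarrow>
     (\<forall>x m L. 1 \<le> m \<longrightarrow> greedy_set e m x L \<longrightarrow>
        norm (x - proj e L x) \<le>
          C * Inf {norm (x - proj e A x) | A. finite A \<and> sum w A \<le> sum w L \<and> set_before {Max L} A})"

definition right_property_A ::
    "real \<Rightarrow> (nat \<Rightarrow> real) \<Rightarrow> (nat \<Rightarrow> 'a::banach) \<Rightarrow> bool" where
  "right_property_A C w e \<longleftrightarrow>
     1 \<le> C \<and>
     (\<forall>x t A B \<epsilon> \<eta>.
        (SUP j. \<bar>coord e j x\<bar>) \<le> t \<longrightarrow> finite A \<longrightarrow> finite B \<longrightarrow> set_before B A \<longrightarrow>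
        sum w A \<le> sum w B \<longrightarrow> supp e x \<inter> (A \<union> B) = {} \<longrightarrow> \<epsilon> \<in> signs \<longrightarrow> \<eta> \<in> signs \<longrightarrow>
        norm (x + t *\<^sub>R signed_sum e \<epsilon> A) \<le> C * norm (x + t *\<^sub>R signed_sum e \<eta> B))"

lemma coord_sums:
  assumes "schauder_basis e"
  shows "(\<lambda>n. coord e n x *\<^sub>R e n) sums x"
proof -
  have "\<exists>!a. (\<lambda>n. a n *\<^sub>R e n) sums x"
    using assms unfolding schauder_basis_def by blast
  from theI'[OF this] show ?thesis
    unfolding coord_def .
qed

lemma coord_unique:
  assumes "schauder_basis e" and "(\<lambda>n. a n *\<^sub>R e n) sums x"
  shows "coord e n x = a n"
proof -
  have "\<exists>!a. (\<lambda>n. a n *\<^sub>R e n) sums x"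
    using assms(1) unfolding schauder_basis_def by blast
  then have "(THE a. (\<lambda>n. a n *\<^sub>R e n) sums x) = a"
    using assms(2) by (rule the1_equality[where P = "\<lambda>a. (\<lambda>n. a n *\<^sub>R e n) sums x"])
  then show ?thesis
    by (simp add: coord_def)
qed

lemma coord_basis:
  assumes "schauder_basis e"
  shows "coord e n (e k) = (if n = k then 1 else 0)"
proof (rule coord_unique[OF assms])
  have "(\<lambda>n. if n = k then e n else 0) sums e k"
    by (rule sums_single)
  moreover have "(\<lambda>n. if n = k then e n else 0) = (\<lambda>n. (if n = k then 1 else 0) *\<^sub>R e n)"
    by auto
  ultimately show "(\<lambda>n. (if n = k then 1 else 0) *\<^sub>R e n) sums e k"
    by simp
qed

lemma coord_add:
  assumes "schauder_basis e"
  shows "coord e n (x + y) = coord e n x + coord e n y"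
  using sums_add[OF coord_sums[OF assms, of x] coord_sums[OF assms, of y]]
  by (intro coord_unique[OF assms, where a = "\<lambda>n. coord e n x + coord e n y"])
     (simp add: scaleR_add_left)

lemma coord_scaleR:
  assumes "schauder_basis e"
  shows "coord e n (c *\<^sub>R x) = c * coord e n x"
  using sums_scaleR_right[OF coord_sums[OF assms, of x], of c]
  by (intro coord_unique[OF assms, where a = "\<lambda>n. c * coord e n x"]) simp

(* In particular the supremum in right_property_A ranges over a bounded set of reals. *)
lemma coord_tendsto_0:
  assumes "schauder_basis e" and "\<And>n. norm (e n) = 1"
  shows "(\<lambda>n. coord e n x) \<longlonglongrightarrow> 0"
proof -
  have "(\<lambda>n. coord e n x *\<^sub>R e n) \<longlonglongrightarrow> 0"
    using coord_sums[OF assms(1)] summable_LIMSEQ_zero sums_summable by blast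
  then have "(\<lambda>n. norm (coord e n x *\<^sub>R e n)) \<longlonglongrightarrow> 0"
    by (rule tendsto_norm_zero)
  then show ?thesis
    by (simp add: assms(2) tendsto_rabs_zero_iff)
qed

lemma bdd_above_coord:
  assumes "schauder_basis e" and "\<And>n. norm (e n) = 1"
  shows "bdd_above (range (\<lambda>j. \<bar>coord e j x\<bar>))"
  using convergent_imp_Bseq[OF convergentI[OF coord_tendsto_0[OF assms]], of x]
  by (auto simp: Bseq_def bdd_above_def)

end

theory Submission
  imports Defs
begin

text \<open>
  For (a), take \<open>A = {}\<close> to get quasi-greediness; for right Property (A), note that \<open>B\<close> is a greedy
  set of \<open>x + t 1\<^bsub>\<epsilon>A\<^esub> + t 1\<^bsub>\<eta>B\<^esub>\<close> and that \<open>A\<close> is one of its competitors.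

  For (b), let \<open>L\<close> be a greedy set of \<open>x\<close>, let \<open>t\<close> be the least modulus of a coefficient on \<open>L\<close>, and
  let \<open>A\<close> be a competitor. As the coefficients of \<open>x\<close> on \<open>A\<close> have modulus at most \<open>t\<close>, convexity allows
  them to be replaced by \<open>\<plusminus>t\<close>, and Property (A) moves them to \<open>L\<close>. What results is the truncation at
  level \<open>t\<close> of \<open>u = x - P\<^sub>A x\<close>, which is an average of vectors \<open>u - G\<^sub>k u\<close>, each of norm at
  most \<open>(C\<^sub>q + 1) \<parallel>u\<parallel>\<close>.
\<close>

section \<open>Coordinates of differences and of finite combinations\<close>

lemma coord_diff:
  assumes "schauder_basis e"
  shows "coord e n (x - y) = coord e n x - coord e n y"
  using coord_add[OF assms, of n x "(-1) *\<^sub>R y"] coord_scaleR[OF assms, of n "-1" y] by simp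

lemma coord_sum_scaleR:
  assumes "schauder_basis e" "finite A"
  shows "coord e n (\<Sum>i\<in>A. a i *\<^sub>R e i) = (if n \<in> A then a n else 0)"
  using assms(2)
proof (induction A rule: finite_induct)
  case empty
  then show ?case using coord_scaleR[OF assms(1), of n 0 0] by simp
next
  case (insert k F)
  then show ?case
    by (auto simp: coord_add[OF assms(1)] coord_scaleR[OF assms(1)] coord_basis[OF assms(1)])
qed

lemma coord_proj:
  assumes "schauder_basis e" "finite A"
  shows "coord e n (proj e A x) = (if n \<in> A then coord e n x else 0)"
  unfolding proj_def by (rule coord_sum_scaleR[OF assms])

lemma coord_signed_sum:
  assumes "schauder_basis e" "finite A"
  shows "coord e n (signed_sum e \<epsilon> A) = (if n \<in> A then \<epsilon> n else 0)"
  unfolding signed_sum_def by (rule coord_sum_scaleR[OF assms])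

section \<open>Two convexity estimates in normed spaces\<close>

text \<open>The cube of coefficients bounded by \<open>t\<close> is the convex hull of its sign
  vertices, and closed balls are convex. The induction treats one coordinate at a time.\<close>

lemma norm_add_combination_le_if_signs:
  fixes v :: "'i \<Rightarrow> 'a::real_normed_vector"
  assumes "finite A" "0 \<le> t" "\<And>n. n \<in> A \<Longrightarrow> \<bar>a n\<bar> \<le> t"
    and "\<And>\<epsilon>. (\<And>i. \<epsilon> i \<in> {1, -1::real}) \<Longrightarrow> norm (z + t *\<^sub>R (\<Sum>i\<in>A. \<epsilon> i *\<^sub>R v i)) \<le> K"
  shows "norm (z + (\<Sum>i\<in>A. a i *\<^sub>R v i)) \<le> K"
  using assms(1,3,4)
proof (induction A arbitrary: z rule: finite_induct)
  case empty
  from empty(2)[of "\<lambda>_. 1"] show ?case by simp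
next
  case (insert k F)
  let ?y = "z + (\<Sum>i\<in>F. a i *\<^sub>R v i)"
  \<comment> \<open>With the coordinate \<open>k\<close> fixed at an endpoint, its term is absorbed
    into \<open>z\<close>; this is why \<open>z\<close> is arbitrary in the induction.\<close>
  have end_le: "norm (?y + (s * t) *\<^sub>R v k) \<le> K" if s: "s \<in> {1, -1}" for s
  proof -
    have "norm ((z + (s * t) *\<^sub>R v k) + (\<Sum>i\<in>F. a i *\<^sub>R v i)) \<le> K"
    proof (rule insert.IH)
      fix \<epsilon> :: "'i \<Rightarrow> real"
      assume \<epsilon>: "\<And>i. \<epsilon> i \<in> {1, -1}"
      have "(\<Sum>i\<in>F. (\<epsilon>(k := s)) i *\<^sub>R v i) = (\<Sum>i\<in>F. \<epsilon> i *\<^sub>R v i)"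
        using insert.hyps(2) by (intro sum.cong) auto
      then have "norm (z + t *\<^sub>R (s *\<^sub>R v k + (\<Sum>i\<in>F. \<epsilon> i *\<^sub>R v i))) \<le> K"
        using insert.prems(2)[of "\<epsilon>(k := s)"] \<epsilon> s insert.hyps by auto
      then show "norm (z + (s * t) *\<^sub>R v k + t *\<^sub>R (\<Sum>i\<in>F. \<epsilon> i *\<^sub>R v i)) \<le> K"
        by (simp add: scaleR_add_right algebra_simps)
    qed (use insert.prems(1) in auto)
    then show ?thesis by (simp add: algebra_simps)
  qed
  have ak: "\<bar>a k\<bar> \<le> t" using insert.prems(1) by simp
  have "norm (?y + a k *\<^sub>R v k) \<le> K"
  proof (cases "t = 0")
    case True
    then show ?thesis using end_le[of 1] ak by simp
  next
    case False
    with assms(2) have t: "0 < t" by simp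
    \<comment> \<open>A point between two endpoints, with convex weights
      \<open>(t + b) / (2 * t)\<close> and \<open>(t - b) / (2 * t)\<close>, cleared of
      denominators.\<close>
    have split: "(t + t) *\<^sub>R (y + b *\<^sub>R v k)
        = (t + b) *\<^sub>R (y + (1 * t) *\<^sub>R v k) + (t - b) *\<^sub>R (y + (-1 * t) *\<^sub>R v k)" for y b
      by (simp only: scaleR_add_left scaleR_diff_left scaleR_add_right scaleR_scaleR)
        (simp add: algebra_simps, simp add: mult_ac flip: scaleR_2)
    have "norm ((t + t) *\<^sub>R (?y + a k *\<^sub>R v k))
        = norm ((t + a k) *\<^sub>R (?y + (1 * t) *\<^sub>R v k) + (t - a k) *\<^sub>R (?y + (-1 * t) *\<^sub>R v k))"
      by (rule arg_cong[OF split])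
    also have "\<dots> \<le> (t + a k) * norm (?y + (1 * t) *\<^sub>R v k)
        + (t - a k) * norm (?y + (-1 * t) *\<^sub>R v k)"
      using ak by (intro norm_triangle_le) simp
    also have "\<dots> \<le> (t + a k) * K + (t - a k) * K"
      using ak end_le[of 1] end_le[of "-1"] by (intro add_mono mult_left_mono) auto
    also have "\<dots> = (t + t) * K" by (simp add: algebra_simps)
    finally show ?thesis using t by simp
  qed
  then show ?case using insert.hyps by (simp add: algebra_simps)
qed

text \<open>Layer cake: \<open>c n\<close> is the length of the set of all \<theta> in
  \<open>[0, M)\<close> with \<open>\<theta> < c n\<close>, so the vector on the left is the
  integral over \<theta> of the vectors in the last hypothesis. The integral is a finite sum,
  obtained by peeling off the lowest positive layer.\<close>

lemma norm_layer_cake_le: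
  fixes v :: "'i \<Rightarrow> 'a::real_normed_vector"
  assumes "finite L" "\<And>n. n \<in> L \<Longrightarrow> 0 \<le> c n" "\<And>n. n \<in> L \<Longrightarrow> c n \<le> M" "0 \<le> M"
    and "\<And>\<theta>. 0 \<le> \<theta> \<Longrightarrow> norm (u - (\<Sum>n\<in>{n\<in>L. \<theta> < c n}. v n)) \<le> K"
  shows "norm (M *\<^sub>R u - (\<Sum>n\<in>L. c n *\<^sub>R v n)) \<le> M * K"
  using assms(2-)
proof (induction "card {n\<in>L. 0 < c n}" arbitrary: c M rule: less_induct)
  case less
  let ?S = "{n\<in>L. 0 < c n}"
  have finS: "finite ?S" using assms(1) by simp
  show ?case
  proof (cases "?S = {}")
    case True
    then have "c n = 0" if "n \<in> L" for n
      using less.prems(1)[OF that] that by fastforce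
    then have "(\<Sum>n\<in>L. c n *\<^sub>R v n) = 0" by simp
    moreover have "norm u \<le> K" using less.prems(4)[of 0] unfolding True by simp
    ultimately show ?thesis using less.prems(3) by (simp add: mult_left_mono)
  next
    case False
    define \<mu> where "\<mu> = Min (c ` ?S)"
    have "\<mu> \<in> c ` ?S" unfolding \<mu>_def using finS False by (intro Min_in) auto
    then obtain k where k: "k \<in> L" "0 < c k" "c k = \<mu>" by auto
    have \<mu>_le: "\<mu> \<le> c n" if "n \<in> ?S" for n
      unfolding \<mu>_def using finS that by (intro Min_le) auto
    \<comment> \<open>Lowering by \<mu> removes \<open>k\<close> from the positive coefficients, so
      the induction measure drops; the level sets of \<open>c'\<close> are those of \<open>c\<close>
      at heights shifted by \<mu>, so the norm hypothesis is inherited.\<close>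
    define c' where "c' n = max (c n - \<mu>) 0" for n
    have level: "{n\<in>L. \<theta> < c' n} = {n\<in>L. \<theta> + \<mu> < c n}" if "0 \<le> \<theta>" for \<theta>
      using that by (auto simp: c'_def)
    have IH: "norm ((M - \<mu>) *\<^sub>R u - (\<Sum>n\<in>L. c' n *\<^sub>R v n)) \<le> (M - \<mu>) * K"
    proof (rule less.hyps)
      have "k \<in> ?S" "k \<notin> {n\<in>L. 0 < c' n}" "{n\<in>L. 0 < c' n} \<subseteq> ?S"
        using k by (auto simp: c'_def)
      then have "{n\<in>L. 0 < c' n} \<subset> ?S" by blast
      then show "card {n\<in>L. 0 < c' n} < card ?S"
        by (rule psubset_card_mono[OF finS])
    next
      fix \<theta> :: real assume "0 \<le> \<theta>"
      then show "norm (u - (\<Sum>n\<in>{n\<in>L. \<theta> < c' n}. v n)) \<le> K"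
        using less.prems(4)[of "\<theta> + \<mu>"] k level by simp
    qed (use less.prems(2) k in \<open>auto simp: c'_def\<close>)
    have "(\<Sum>n\<in>L. c n *\<^sub>R v n) = (\<Sum>n\<in>L. c' n *\<^sub>R v n + (if 0 < c n then \<mu> *\<^sub>R v n else 0))"
    proof (intro sum.cong refl)
      fix n assume n: "n \<in> L"
      have "c n = c' n + (if 0 < c n then \<mu> else 0)"
        using n less.prems(1)[OF n] \<mu>_le[of n] k by (auto simp: c'_def)
      then show "c n *\<^sub>R v n = c' n *\<^sub>R v n + (if 0 < c n then \<mu> *\<^sub>R v n else 0)"
        by (cases "0 < c n") (simp_all add: scaleR_add_left[symmetric])
    qed
    also have "\<dots> = (\<Sum>n\<in>L. c' n *\<^sub>R v n) + \<mu> *\<^sub>R (\<Sum>n\<in>?S. v n)"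
      using assms(1) by (simp add: sum.distrib scaleR_sum_right flip: sum.inter_filter)
    finally have "M *\<^sub>R u - (\<Sum>n\<in>L. c n *\<^sub>R v n)
        = ((M - \<mu>) *\<^sub>R u - (\<Sum>n\<in>L. c' n *\<^sub>R v n)) + \<mu> *\<^sub>R (u - (\<Sum>n\<in>?S. v n))"
      by (simp add: algebra_simps)
    also have "norm \<dots> \<le> (M - \<mu>) * K + \<mu> * K"
      using IH less.prems(4)[of 0] k by (intro norm_triangle_le add_mono) (auto intro: mult_left_mono)
    finally show ?thesis by (simp add: algebra_simps)
  qed
qed

section \<open>Consequences of reverse partial greediness\<close>

lemma reverse_partially_greedyD:
  assumes "reverse_partially_greedy C w e" "0 \<le> C" "greedy_set e m x L" "1 \<le> m"
    and "finite A" "sum w A \<le> sum w L" "set_before {Max L} A"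
  shows "norm (x - proj e L x) \<le> C * norm (x - proj e A x)"
proof -
  let ?R = "{norm (x - proj e A x) |A. finite A \<and> sum w A \<le> sum w L \<and> set_before {Max L} A}"
  have "norm (x - proj e L x) \<le> C * Inf ?R"
    using assms(1,3,4) unfolding reverse_partially_greedy_def by blast
  also have "\<dots> \<le> C * norm (x - proj e A x)"
    using assms(2,5-7) by (intro mult_left_mono cInf_lower bdd_belowI[of _ 0]) auto
  finally show ?thesis .
qed

text \<open>
  If \<open>C < 1\<close>, each of the sums \<open>s n = e 0 + \<dots> + e n\<close> would satisfy \<open>\<parallel>s n\<parallel> \<le> C \<parallel>s (n + 1)\<parallel>\<close>, so their
  norms would grow geometrically, although \<open>\<parallel>s n\<parallel> \<le> n + 1\<close>.
\<close>
lemma reverse_partially_greedy_ge_1: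
  assumes sb: "schauder_basis e" and n1: "\<And>n. norm (e n) = 1" and w: "weight w"
    and rp: "reverse_partially_greedy C w e"
  shows "1 \<le> C"
proof (rule ccontr)
  assume "\<not> 1 \<le> C"
  define s where "s n = (\<Sum>i\<le>n. 1 *\<^sub>R e i)" for n
  have coord_s: "coord e k (s n) = (if k \<le> n then 1 else 0)" for k n
    unfolding s_def by (simp only: coord_sum_scaleR[OF sb finite_atMost] atMost_iff)
  \<comment> \<open>All nonzero coefficients of \<open>s n\<close> tie at 1, so any single index up
    to \<open>n\<close> may be chosen.\<close>
  have greedy: "greedy_set e 1 (s n) {k}" if "k \<le> n" for n k
    using that by (auto simp: greedy_set_def coord_s)
  \<comment> \<open>Passing from the infimum to a single competitor already requires
    \<open>0 \<le> C\<close>, so the sign is settled on the infimum itself: removing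
    \<open>e 0\<close> from \<open>s 1\<close> leaves norm 1, and the infimum is
    nonnegative.\<close>
  have C0: "0 \<le> C"
  proof (rule ccontr)
    assume neg: "\<not> 0 \<le> C"
    let ?R = "{norm (s 1 - proj e A (s 1)) |A.
      finite A \<and> sum w A \<le> sum w {0} \<and> set_before {Max {0}} A}"
    have "norm (s 1 - proj e {0} (s 1)) \<le> C * Inf ?R"
      using rp greedy[of 0 1] unfolding reverse_partially_greedy_def by blast
    moreover have "s 1 - proj e {0} (s 1) = e 1"
      by (simp add: proj_def coord_s) (simp add: s_def)
    moreover have "0 \<le> Inf ?R"
    proof (rule cInf_greatest)
      have "finite {} \<and> sum w {} \<le> sum w {0} \<and> set_before {Max {0}} {}"
        using w by (simp add: set_before_def weight_def less_imp_le)
      then show "?R \<noteq> {}" by blast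
    qed auto
    ultimately have "1 \<le> C * Inf ?R" using n1 by simp
    then show False using neg \<open>0 \<le> Inf ?R\<close> mult_nonpos_nonneg[of C "Inf ?R"] by linarith
  qed
  have step: "norm (s n) \<le> C * norm (s (Suc n))" for n
  proof -
    have "norm (s (Suc n) - proj e {Suc n} (s (Suc n))) \<le> C * norm (s (Suc n) - proj e {} (s (Suc n)))"
      using w by (intro reverse_partially_greedyD[OF rp C0 greedy])
        (auto simp: set_before_def weight_def less_imp_le)
    moreover have "s (Suc n) - proj e {Suc n} (s (Suc n)) = s n"
      by (simp add: proj_def coord_s) (simp add: s_def)
    ultimately show ?thesis by (simp add: proj_def)
  qed
  have grow: "1 \<le> C ^ n * norm (s n)" for n
  proof (induction n)
    case 0
    then show ?case by (simp add: s_def n1)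
  next
    case (Suc n)
    have "C ^ n * norm (s n) \<le> C ^ n * (C * norm (s (Suc n)))"
      using step C0 by (intro mult_left_mono) auto
    with Suc show ?case by (simp add: algebra_simps)
  qed
  have lin: "norm (s n) \<le> real n + 1" for n
    using norm_sum[of "\<lambda>i. 1 *\<^sub>R e i" "{..n}"] by (simp add: s_def n1)
  have "1 \<le> real n * C ^ n + C ^ n" for n
  proof -
    have "C ^ n * norm (s n) \<le> C ^ n * (real n + 1)"
      using lin C0 by (intro mult_left_mono) auto
    with grow[of n] show ?thesis by (simp add: algebra_simps)
  qed
  moreover have "(\<lambda>n. real n * C ^ n + C ^ n) \<longlonglongrightarrow> 0 + 0"
    using \<open>\<not> 1 \<le> C\<close> C0 by (intro tendsto_add powser_times_n_limit_0 LIMSEQ_power_zero) auto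
  ultimately show False
    using LIMSEQ_le_const[of _ "0 + 0 :: real" 1] by force
qed

lemma reverse_partially_greedy_imp_quasi_greedy:
  assumes sb: "schauder_basis e" and n1: "\<And>n. norm (e n) = 1" and w: "weight w"
    and rp: "reverse_partially_greedy C w e"
  shows "quasi_greedy (C + 1) e"
  unfolding quasi_greedy_def
proof (intro allI impI)
  fix x m L assume m: "1 \<le> m" and L: "greedy_set e m x L"
  have "norm (x - proj e L x) \<le> C * norm (x - proj e {} x)"
    using w reverse_partially_greedy_ge_1[OF assms]
    by (intro reverse_partially_greedyD[OF rp _ L m])
      (auto simp: set_before_def weight_def less_imp_le intro: sum_nonneg)
  then show "norm (proj e L x) \<le> (C + 1) * norm x"
    using norm_triangle_ineq4[of x "x - proj e L x"] by (simp add: proj_def algebra_simps)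
qed

lemma reverse_partially_greedy_imp_right_property_A:
  assumes sb: "schauder_basis e" and n1: "\<And>n. norm (e n) = 1" and w: "weight w"
    and rp: "reverse_partially_greedy C w e"
  shows "right_property_A C w e"
  unfolding right_property_A_def
proof (intro conjI allI impI)
  show C1: "1 \<le> C" by (rule reverse_partially_greedy_ge_1[OF assms])
  fix x t A B \<epsilon> \<eta>
  assume t: "(SUP j. \<bar>coord e j x\<bar>) \<le> t" and fin: "finite A" "finite B"
    and before: "set_before B A" and wAB: "sum w A \<le> sum w B"
    and disj: "supp e x \<inter> (A \<union> B) = {}" and sg: "\<epsilon> \<in> signs" "\<eta> \<in> signs"
  show "norm (x + t *\<^sub>R signed_sum e \<epsilon> A) \<le> C * norm (x + t *\<^sub>R signed_sum e \<eta> B)"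
  \<comment> \<open>Greediness is only assumed for nonempty index sets. If \<open>B\<close> is
    empty, positivity of the weights forces \<open>A\<close> to be empty as well.\<close>
  proof (cases "B = {}")
    case True
    have "A = {}"
    proof (rule ccontr)
      assume "A \<noteq> {}"
      then have "0 < sum w A" using w fin(1) by (intro sum_pos) (auto simp: weight_def)
      then show False using wAB True by simp
    qed
    then show ?thesis
      using True C1 by (simp add: signed_sum_def mult_le_cancel_right1)
  next
    case False
    define y where "y = x + t *\<^sub>R signed_sum e \<epsilon> A + t *\<^sub>R signed_sum e \<eta> B"
    have coord_le: "\<bar>coord e j x\<bar> \<le> t" for j
      using cSUP_upper[OF UNIV_I bdd_above_coord[OF sb n1], of j x] t by linarith
    then have t0: "0 \<le> t" using abs_ge_zero order_trans by blast
    have AB: "A \<inter> B = {}" using before by (fastforce simp: set_before_def)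
    have x0: "coord e n x = 0" if "n \<in> A \<union> B" for n
      using disj that by (auto simp: supp_def)
    have coord_y: "coord e n y =
        coord e n x + t * (if n \<in> A then \<epsilon> n else 0) + t * (if n \<in> B then \<eta> n else 0)" for n
      by (simp add: y_def coord_add[OF sb] coord_scaleR[OF sb] coord_signed_sum[OF sb] fin)
    have yA: "coord e n y = t * \<epsilon> n" if "n \<in> A" for n
      using that AB x0[of n] by (auto simp: coord_y)
    have yB: "coord e n y = t * \<eta> n" if "n \<in> B" for n
      using that AB x0[of n] by (auto simp: coord_y)
    have abs1: "\<bar>\<epsilon> n\<bar> = 1" "\<bar>\<eta> n\<bar> = 1" for n
      using sg by (auto simp: signs_def) (metis abs_1 abs_minus_cancel)+
    \<comment> \<open>The coefficients of \<open>y\<close> have modulus exactly \<open>t\<close> on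
      \<open>B\<close> and at most \<open>t\<close> elsewhere; ties with \<open>A\<close> are
      harmless because every admissible choice is covered.\<close>
    have greedy: "greedy_set e (card B) y B"
      unfolding greedy_set_def
    proof (intro conjI ballI allI impI)
      fix n k assume n: "n \<in> B" and k: "k \<notin> B"
      have "\<bar>coord e k y\<bar> \<le> t"
        by (cases "k \<in> A") (use yA t0 abs1 k coord_le in \<open>auto simp: abs_mult coord_y x0\<close>)
      then show "\<bar>coord e k y\<bar> \<le> \<bar>coord e n y\<bar>"
        using yB[OF n] t0 abs1 by (simp add: abs_mult)
    qed (use fin in auto)
    have pB: "proj e B y = t *\<^sub>R signed_sum e \<eta> B"
      by (simp add: proj_def signed_sum_def scaleR_sum_right yB cong: sum.cong)
    have pA: "proj e A y = t *\<^sub>R signed_sum e \<epsilon> A"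
      by (simp add: proj_def signed_sum_def scaleR_sum_right yA cong: sum.cong)
    have "norm (y - proj e B y) \<le> C * norm (y - proj e A y)"
    proof (rule reverse_partially_greedyD[OF rp _ greedy])
      show "set_before {Max B} A"
        using before Max_in[OF fin(2) False] by (auto simp: set_before_def)
    qed (use C1 fin wAB False in \<open>auto simp: Suc_le_eq card_gt_0_iff\<close>)
    then show ?thesis unfolding pA pB by (simp add: y_def)
  qed
qed

section \<open>Quasi-greedy truncation and the converse implication\<close>

lemma quasi_greedy_ge_1:
  assumes sb: "schauder_basis e" and n1: "\<And>n. norm (e n) = 1" and qg: "quasi_greedy C e"
  shows "1 \<le> C"
proof -
  have "greedy_set e 1 (e 0) {0}"
    by (auto simp: greedy_set_def coord_basis[OF sb])
  then have "norm (proj e {0} (e 0)) \<le> C * norm (e 0)"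
    using qg by (auto simp: quasi_greedy_def)
  then show ?thesis by (simp add: proj_def coord_basis[OF sb] n1)
qed

lemma quasi_greedy_norm_diff_le:
  assumes sb: "schauder_basis e" and n1: "\<And>n. norm (e n) = 1" and qg: "quasi_greedy C e"
    and G: "greedy_set e m u G"
  shows "norm (u - proj e G u) \<le> (C + 1) * norm u"
\<comment> \<open>Quasi-greediness speaks only of \<open>1 \<le> m\<close>, while the level sets
  used for truncation may be empty.\<close>
proof (cases "G = {}")
  case True
  then show ?thesis
    using quasi_greedy_ge_1[OF sb n1 qg] by (simp add: proj_def mult_le_cancel_right1)
next
  case False
  then have "1 \<le> m" using G by (auto simp: greedy_set_def Suc_le_eq card_gt_0_iff)
  then have "norm (proj e G u) \<le> C * norm u"
    using qg G by (auto simp: quasi_greedy_def)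
  then show ?thesis
    using norm_triangle_ineq4[of u "proj e G u"] by (simp add: algebra_simps)
qed

text \<open>Truncation on \<open>L\<close> scales away the fraction
  \<open>1 - t / \<bar>coord e n u\<bar>\<close> of each coefficient. This fraction grows with the
  modulus, so its level sets are greedy sets of \<open>u\<close>, and the layer cake bound with
  \<open>M = 1\<close> applies. Unlike \<open>sgn\<close>, \<eta> has modulus 1 also at zero
  coefficients.\<close>

lemma quasi_greedy_truncation_le:
  assumes sb: "schauder_basis e" and n1: "\<And>n. norm (e n) = 1" and qg: "quasi_greedy C e"
    and L: "greedy_set e m u L" and t0: "0 \<le> t" and t: "\<And>n. n \<in> L \<Longrightarrow> t \<le> \<bar>coord e n u\<bar>"
    and \<eta>: "\<And>n. \<bar>coord e n u\<bar> = \<eta> n * coord e n u" "\<And>n. \<bar>\<eta> n\<bar> = 1"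
  shows "norm (u - proj e L u + t *\<^sub>R signed_sum e \<eta> L) \<le> (C + 1) * norm u"
proof -
  \<comment> \<open>A zero coefficient on \<open>L\<close> forces \<open>t = 0\<close>; division by
    zero then yields \<open>c n = 1\<close>, which stays in range and multiplies a zero
    vector.\<close>
  define c where "c n = 1 - t / \<bar>coord e n u\<bar>" for n
  have finL: "finite L" using L by (simp add: greedy_set_def)
  have c_range: "0 \<le> c n \<and> c n \<le> 1" if "n \<in> L" for n
    using t[OF that] t0 by (auto simp: c_def divide_le_eq)
  have c_mono: "\<bar>coord e k u\<bar> \<le> \<bar>coord e n u\<bar>" if "k \<in> L" "n \<in> L" "c k < c n" for k n
  proof (rule ccontr)
    assume neg: "\<not> \<bar>coord e k u\<bar> \<le> \<bar>coord e n u\<bar>"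
    have "t / \<bar>coord e k u\<bar> \<le> t / \<bar>coord e n u\<bar>"
    proof (cases "coord e n u = 0")
      case True
      then have "t = 0" using t[OF that(2)] t0 by simp
      then show ?thesis by simp
    next
      case False
      then show ?thesis using neg t0 by (intro divide_left_mono) auto
    qed
    then show False using that(3) by (simp add: c_def)
  qed
  have "norm (1 *\<^sub>R u - (\<Sum>n\<in>L. c n *\<^sub>R (coord e n u *\<^sub>R e n))) \<le> 1 * ((C + 1) * norm u)"
  proof (rule norm_layer_cake_le[OF finL])
    fix \<theta> :: real assume "0 \<le> \<theta>"
    \<comment> \<open>Indices of \<open>L\<close> left out of \<open>?G\<close> have a strictly
      smaller \<open>c\<close>, hence no larger modulus; indices outside \<open>L\<close> are
      handled by greediness of \<open>L\<close>.\<close>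
    let ?G = "{n\<in>L. \<theta> < c n}"
    have "greedy_set e (card ?G) u ?G"
      unfolding greedy_set_def
    proof (intro conjI ballI allI impI)
      fix n k assume n: "n \<in> ?G" and k: "k \<notin> ?G"
      show "\<bar>coord e k u\<bar> \<le> \<bar>coord e n u\<bar>"
      proof (cases "k \<in> L")
        case True
        then show ?thesis using n k by (intro c_mono) auto
      next
        case False
        then show ?thesis using L n by (auto simp: greedy_set_def)
      qed
    qed (use finL in auto)
    from quasi_greedy_norm_diff_le[OF sb n1 qg this]
    show "norm (u - (\<Sum>n\<in>?G. coord e n u *\<^sub>R e n)) \<le> (C + 1) * norm u"
      by (simp add: proj_def)
  qed (use c_range in auto)
  moreover have "(\<Sum>n\<in>L. c n *\<^sub>R (coord e n u *\<^sub>R e n)) = proj e L u - t *\<^sub>R signed_sum e \<eta> L"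
  proof -
    have "c n * coord e n u = coord e n u - t * \<eta> n" if "n \<in> L" for n
    proof (cases "coord e n u = 0")
      case True
      then show ?thesis using t[OF that] t0 by simp
    next
      case False
      have "\<eta> n * \<eta> n = 1" using \<eta>(2)[of n] by (metis abs_mult_self mult_1)
      then have "coord e n u = \<eta> n * \<bar>coord e n u\<bar>"
        by (simp add: \<eta>(1) flip: mult.assoc)
      then have "coord e n u / \<bar>coord e n u\<bar> = \<eta> n"
        using False by (metis abs_eq_0 nonzero_mult_div_cancel_right)
      with False show ?thesis
        by (simp only: c_def left_diff_distrib mult_1 times_divide_eq_left times_divide_eq_right[symmetric])
    qed
    then show ?thesis
      by (simp add: proj_def signed_sum_def scaleR_sum_right scaleR_diff_left
          flip: sum_subtractf cong: sum.cong)
  qed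
  ultimately show ?thesis
    by (simp only: scaleR_one mult_1 diff_diff_eq2 diff_add_eq)
qed

lemma right_property_A_quasi_greedy_imp_reverse_partially_greedy:
  assumes sb: "schauder_basis e" and n1: "\<And>n. norm (e n) = 1" and w: "weight w"
    and ra: "right_property_A C\<^sub>r\<^sub>a w e" and qg: "quasi_greedy C\<^sub>q e"
  shows "reverse_partially_greedy ((C\<^sub>q + 1) * C\<^sub>r\<^sub>a) w e"
  unfolding reverse_partially_greedy_def
proof (intro allI impI)
  fix x m L assume m: "1 \<le> m" and L: "greedy_set e m x L"
  let ?R = "{norm (x - proj e A x) |A. finite A \<and> sum w A \<le> sum w L \<and> set_before {Max L} A}"
  let ?K = "(C\<^sub>q + 1) * C\<^sub>r\<^sub>a"
  have ra1: "1 \<le> C\<^sub>r\<^sub>a" using ra by (simp add: right_property_A_def)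
  have K: "0 < ?K" using ra1 quasi_greedy_ge_1[OF sb n1 qg] by simp
  have finL: "finite L" using L by (simp add: greedy_set_def)
  have Lne: "L \<noteq> {}" using L m by (auto simp: greedy_set_def)
  \<comment> \<open>The minimum is attained on \<open>L\<close>, so greediness makes
    \<open>t\<close> also an upper bound for all moduli off \<open>L\<close>.\<close>
  define t where "t = Min ((\<lambda>n. \<bar>coord e n x\<bar>) ` L)"
  have "t \<in> (\<lambda>n. \<bar>coord e n x\<bar>) ` L"
    unfolding t_def using finL Lne by (intro Min_in) auto
  then obtain l where l: "l \<in> L" "t = \<bar>coord e l x\<bar>" by auto
  have t_le: "t \<le> \<bar>coord e n x\<bar>" if "n \<in> L" for n
    unfolding t_def using finL that by (intro Min_le) auto
  have le_t: "\<bar>coord e k x\<bar> \<le> t" if "k \<notin> L" for k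
    using L l that by (auto simp: greedy_set_def)
  have t0: "0 \<le> t" using l by simp
  have bound: "norm (x - proj e L x) \<le> ?K * norm (x - proj e A x)"
    if A: "finite A" "sum w A \<le> sum w L" "set_before {Max L} A" for A
  proof -
    have LA: "set_before L A"
      using A(3) Max_ge[OF finL] by (fastforce simp: set_before_def)
    then have disj: "n \<notin> A" if "n \<in> L" for n
      using that by (fastforce simp: set_before_def)
    define u where "u = x - proj e A x"
    \<comment> \<open>\<open>z\<close> lacks the coefficients on both \<open>A\<close> and
      \<open>L\<close>, so its support avoids both and its moduli are at most \<open>t\<close>, as
      Property (A) requires.\<close>
    define z where "z = u - proj e L u"
    define \<eta> :: "nat \<Rightarrow> real" where "\<eta> n = (if 0 \<le> coord e n u then 1 else -1)" for n
    have coord_u: "coord e n u = (if n \<in> A then 0 else coord e n x)" for n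
      by (simp add: u_def coord_diff[OF sb] coord_proj[OF sb A(1)])
    have coord_z: "coord e n z = (if n \<in> A \<union> L then 0 else coord e n x)" for n
      by (simp add: z_def coord_diff[OF sb] coord_proj[OF sb finL] coord_u)
    have pL: "proj e L u = proj e L x"
      unfolding proj_def using disj by (intro sum.cong) (auto simp: coord_u)
    \<comment> \<open>Passing from \<open>x\<close> to \<open>u\<close> only zeroes coefficients off
      \<open>L\<close>.\<close>
    have greedy_u: "greedy_set e m u L"
      using L disj by (auto simp: greedy_set_def coord_u)
    have "norm (z + (\<Sum>n\<in>A. coord e n x *\<^sub>R e n)) \<le> C\<^sub>r\<^sub>a * norm (z + t *\<^sub>R signed_sum e \<eta> L)"
    proof (rule norm_add_combination_le_if_signs[OF A(1) t0])
      show "\<bar>coord e n x\<bar> \<le> t" if "n \<in> A" for n using that disj le_t by blast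
      fix \<epsilon> :: "nat \<Rightarrow> real" assume "\<And>i. \<epsilon> i \<in> {1, -1}"
      then have "\<epsilon> \<in> signs" "\<eta> \<in> signs" by (auto simp: signs_def \<eta>_def)
      moreover have "(SUP j. \<bar>coord e j z\<bar>) \<le> t"
        using t0 le_t by (intro cSUP_least) (auto simp: coord_z)
      moreover have "supp e z \<inter> (A \<union> L) = {}"
        by (auto simp: supp_def coord_z)
      ultimately have "norm (z + t *\<^sub>R signed_sum e \<epsilon> A) \<le> C\<^sub>r\<^sub>a * norm (z + t *\<^sub>R signed_sum e \<eta> L)"
        using ra A finL LA unfolding right_property_A_def by blast
      then show "norm (z + t *\<^sub>R (\<Sum>i\<in>A. \<epsilon> i *\<^sub>R e i))
          \<le> C\<^sub>r\<^sub>a * norm (z + t *\<^sub>R signed_sum e \<eta> L)"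
        by (simp add: signed_sum_def)
    qed
    moreover have "z + (\<Sum>n\<in>A. coord e n x *\<^sub>R e n) = x - proj e L x"
      by (simp add: z_def pL) (simp add: u_def proj_def)
    moreover have "norm (z + t *\<^sub>R signed_sum e \<eta> L) \<le> (C\<^sub>q + 1) * norm u"
      unfolding z_def using t_le disj
      by (intro quasi_greedy_truncation_le[OF sb n1 qg greedy_u t0]) (auto simp: coord_u \<eta>_def)
    then have "C\<^sub>r\<^sub>a * norm (z + t *\<^sub>R signed_sum e \<eta> L) \<le> C\<^sub>r\<^sub>a * ((C\<^sub>q + 1) * norm u)"
      using ra1 by (intro mult_left_mono) auto
    ultimately show ?thesis by (simp add: u_def mult_ac)
  qed
  \<comment> \<open>Dividing by \<open>?K\<close> turns \<open>bound\<close> into a lower bound for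
    all competitors; the empty competitor keeps the infimum from being taken over an empty
    set.\<close>
  have "norm (x - proj e L x) / ?K \<le> Inf ?R"
  proof (rule cInf_greatest)
    have "finite {} \<and> sum w {} \<le> sum w L \<and> set_before {Max L} {}"
      using w by (auto simp: set_before_def weight_def less_imp_le intro: sum_nonneg)
    then show "?R \<noteq> {}" by blast
  next
    fix r assume "r \<in> ?R"
    then show "norm (x - proj e L x) / ?K \<le> r"
      using bound K by (auto simp: divide_le_eq mult.commute)
  qed
  then show "norm (x - proj e L x) \<le> ?K * Inf ?R"
    using K by (simp add: divide_le_eq mult.commute)
qed

theorem theorem3p13:
  fixes e :: "nat \<Rightarrow> 'a::banach" and w :: "nat \<Rightarrow> real"
  assumes "schauder_basis e"
    and "\<And>n. norm (e n) = 1"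
    and "weight w"
  shows "(\<forall>C\<^sub>r\<^sub>p. reverse_partially_greedy C\<^sub>r\<^sub>p w e \<longrightarrow>
            quasi_greedy (C\<^sub>r\<^sub>p + 1) e \<and> right_property_A C\<^sub>r\<^sub>p w e)
       \<and> (\<forall>C\<^sub>r\<^sub>a C\<^sub>q. right_property_A C\<^sub>r\<^sub>a w e \<and> quasi_greedy C\<^sub>q e \<longrightarrow>
            reverse_partially_greedy ((C\<^sub>q + 1) * C\<^sub>r\<^sub>a) w e)"
  using reverse_partially_greedy_imp_quasi_greedy[OF assms]
    reverse_partially_greedy_imp_right_property_A[OF assms]
    right_property_A_quasi_greedy_imp_reverse_partially_greedy[OF assms]
  by blast

end
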